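(* For all integers $k\geq2$ and $\eta\geq0$, $$\sum_{\ell=1}^{\eta+1}\binom{2\eta+2}{2\ell}B_{2\eta-2\ell+2}\left(\tfrac12\right)\cdot B_{2\ell}\cdot\left(k^{2\ell}-1\right)=\frac{(2\eta+2)!}{4^{\eta+1}}\sum_{\ell=0}^{\eta}C_{\ell,k}\cdot d_{2\ell}(2\eta),$$ where $$C_{\ell,k}:=\sum_{\tau=0}^{\ell}\binom{\frac12}{\tau}(-1)^{\ell-\tau}\cdot\sum_{j=1}^{k-1}\frac{1}{\sin\left(j\cdot\frac{\pi}{k}\right)^{2(\ell-\tau)+2}} .$$
   Context: The Bernoulli polynomials $B_m(x)$ are defined by $\frac{te^{xt}}{e^t-1}=\sum_{m\ge0}B_m(x)\frac{t^m}{m!}$ for $|t|<2\pi$, and $B_m:=B_m(0)$. For $n,\eta\in\mathbb{N}_0$ the coefficients $d_n(\eta)$ are defined by the generating function $\sinh^n(r)=\sum_{\eta=0}^\infty d_n(\eta)\,r^\eta$ for all $r\in\mathbb{R}$ (so $d_0(0)=1$ and $d_0(\eta)=0$ for $\eta\ge1$). *)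

theory Defs
  imports "HOL-Complex_Analysis.Complex_Analysis"
begin

text \<open>
  The generating functions are read as formal power series; \<open>/\<close> is division of formal power
  series, so the common factor \<open>t\<close> in \<open>t * exp (x * t) / (exp t - 1)\<close> is cancelled.  The lemmas
  \<open>bernpoly_sums\<close> and \<open>sinh_coeff_sums\<close> below recover the analytic expansions, which in turn
  determine the coefficients.
\<close>

definition bernpoly :: "nat \<Rightarrow> real \<Rightarrow> real" where
  "bernpoly m x = fact m * fps_nth (fps_X * fps_exp x / (fps_exp 1 - 1)) m"

definition bernoulli :: "nat \<Rightarrow> real" where
  "bernoulli m = bernpoly m 0"

definition fps_sinh :: "real fps" where
  "fps_sinh = fps_const (1/2) * (fps_exp 1 - fps_exp (-1))"

definition sinh_coeff :: "nat \<Rightarrow> nat \<Rightarrow> real" where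
  "sinh_coeff n \<eta> = fps_nth (fps_sinh ^ n) \<eta>"

definition cosec_coeff :: "nat \<Rightarrow> nat \<Rightarrow> real" where
  "cosec_coeff l k =
     (\<Sum>\<tau>=0..l. ((1/2) gchoose \<tau>) * (-1) ^ (l - \<tau>) *
        (\<Sum>j=1..k-1. 1 / sin (real j * (pi / real k)) ^ (2 * (l - \<tau>) + 2)))"

lemma bernpoly_sums:
  fixes x :: real and t :: complex
  assumes "norm t < 2 * pi" "t \<noteq> 0"
  shows "(\<lambda>m. of_real (bernpoly m x) * t ^ m / fact m) sums
           (t * exp (of_real x * t) / (exp t - 1))"
proof -
  define F where "F = fps_X * fps_exp x / (fps_exp (1::real) - 1)"
  define G where "G = Abs_fps (\<lambda>n. of_real (fps_nth F n) :: complex)"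
  have nz: "fps_nth (fps_exp (1::real) - 1) 1 \<noteq> 0" by simp
  have sd: "subdegree (fps_exp (1::real) - 1) = 1"
    by (intro subdegreeI) auto
  have nz0: "fps_exp (1::real) - 1 \<noteq> 0" using nz by force
  have sn: "subdegree (fps_X * fps_exp x) = 1"
    by (intro subdegreeI) auto
  hence nz1: "fps_X * fps_exp x \<noteq> 0" by force
  hence dv: "fps_exp (1::real) - 1 dvd fps_X * fps_exp x"
    unfolding fps_dvd_iff[OF nz0 nz1] sd sn by simp
  have F: "F * (fps_exp 1 - 1) = fps_X * fps_exp x"
    unfolding F_def using dv by simp
  have G: "G * (fps_exp 1 - 1) = fps_X * fps_exp (of_real x)"
  proof (rule fps_ext)
    fix n
    have "fps_nth (G * (fps_exp 1 - 1)) n = of_real (fps_nth (F * (fps_exp 1 - 1)) n)"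
      by (simp add: fps_mult_nth G_def if_distrib[of complex_of_real] cong: if_cong)
    also have "\<dots> = fps_nth (fps_X * fps_exp (complex_of_real x)) n"
      unfolding F by simp
    finally show "fps_nth (G * (fps_exp 1 - 1)) n = fps_nth (fps_X * fps_exp (complex_of_real x)) n" .
  qed
  have "fps_nth (fps_exp (1::complex) - 1) 1 \<noteq> 0" by simp
  hence nzc: "fps_exp (1::complex) - 1 \<noteq> 0" by force
  have sdc: "subdegree (fps_exp (1::complex) - 1) = 1"
    by (intro subdegreeI) auto
  have sdn: "subdegree (fps_X * fps_exp (complex_of_real x)) = 1"
    by (intro subdegreeI) auto
  have G': "G = fps_X * fps_exp (of_real x) / (fps_exp 1 - 1)"
    using G nzc by (metis nonzero_mult_div_cancel_right)
  have ne: "exp z \<noteq> 1" if "norm z < 2 * pi" "z \<noteq> 0" for z :: complex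
  proof
    assume "exp z = 1"
    then obtain n :: int where n: "Re z = 0" "Im z = of_int (2 * n) * pi"
      by (auto simp: exp_eq_1)
    with that(2) have "n \<noteq> 0" by (auto simp: complex_eq_iff)
    hence "1 \<le> \<bar>real_of_int n\<bar>" by linarith
    hence "2 * pi \<le> \<bar>Im z\<bar>" by (simp add: n abs_mult)
    with that(1) abs_Im_le_cmod[of z] show False by linarith
  qed
  have r1: "fps_conv_radius (fps_exp 1 - 1 :: complex fps) \<ge> ereal (2 * pi)"
    by (rule order_trans[OF _ fps_conv_radius_diff]) simp
  have r2: "fps_conv_radius (fps_X * fps_exp (complex_of_real x)) \<ge> ereal (2 * pi)"
    by (rule order_trans[OF _ fps_conv_radius_mult]) simp
  have ev1: "eval_fps (fps_exp 1 - 1 :: complex fps) z = exp z - 1" for z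
    by (subst eval_fps_diff) auto
  have ev2: "eval_fps (fps_X * fps_exp (complex_of_real x)) z = z * exp (of_real x * z)" for z
    by (subst eval_fps_mult) auto
  have nzz: "eval_fps (fps_exp 1 - 1 :: complex fps) z \<noteq> 0"
    if "ereal (norm z) < ereal (2 * pi)" "z \<noteq> 0" for z
    using ne[of z] that by (simp add: ev1)
  have tr: "ereal (norm t) < ereal (2 * pi)" using assms by simp
  have pos: "0 < fps_conv_radius (fps_exp 1 - 1 :: complex fps)"
    "0 < fps_conv_radius (fps_X * fps_exp (complex_of_real x))"
    using less_le_trans[OF _ r1, of 0] less_le_trans[OF _ r2, of 0] by auto
  have R: "ereal (2*pi) \<le> Min {ereal (2*pi), fps_conv_radius (fps_X * fps_exp (complex_of_real x)),
             fps_conv_radius (fps_exp 1 - 1 :: complex fps)}"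
    using r1 r2 by simp
  have sle: "subdegree (fps_exp (1::complex) - 1) \<le> subdegree (fps_X * fps_exp (complex_of_real x))"
    unfolding sdc sdn by simp
  note div = sle pos(2,1) _ nzz
  have rad: "fps_conv_radius G \<ge> ereal (2 * pi)"
    unfolding G' by (rule order_trans[OF R fps_conv_radius_divide[OF div]]) auto
  have "eval_fps G t = t * exp (of_real x * t) / (exp t - 1)"
    unfolding G' using assms
    by (subst eval_fps_divide[OF div less_le_trans[OF tr R] refl]) (auto simp: ev1 ev2)
  moreover have "(\<lambda>n. fps_nth G n * t ^ n) sums eval_fps G t"
    using less_le_trans[OF tr rad] by (rule sums_eval_fps)
  ultimately show ?thesis
    by (simp add: G_def F_def bernpoly_def)
qed

lemma sinh_coeff_sums: "(\<lambda>\<eta>. sinh_coeff n \<eta> * r ^ \<eta>) sums (sinh r ^ n)"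
proof -
  have R: "fps_conv_radius fps_sinh = \<infinity>"
  proof -
    have "\<infinity> \<le> fps_conv_radius (fps_exp 1 - fps_exp (-1) :: real fps)"
      by (rule order_trans[OF _ fps_conv_radius_diff]) simp
    thus ?thesis unfolding fps_sinh_def by (subst fps_conv_radius_cmult_left) auto
  qed
  have e: "eval_fps fps_sinh r = sinh r"
    unfolding fps_sinh_def
    by (subst eval_fps_mult; (subst eval_fps_diff)?)
       (auto simp: sinh_def intro!: less_le_trans[OF _ fps_conv_radius_diff])
  have "ereal (norm r) < fps_conv_radius (fps_sinh ^ n)"
    using fps_conv_radius_power[of fps_sinh n] by (simp add: R)
  from sums_eval_fps[OF this] show ?thesis
    by (simp add: sinh_coeff_def eval_fps_power R e)
qed

end

theory Submission
  imports Defs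
begin

text \<open>
  With \<open>r = t / 2\<close>, the left-hand side is \<open>(2 * \<eta> + 2)! / 4 ^ (\<eta> + 1)\<close> times the coefficient of
  \<open>r ^ (2 * \<eta>)\<close> in \<open>(k * coth (k * r) - coth r) / sinh r\<close>, because \<open>t / (exp t - 1)\<close> has even part
  \<open>r * coth r\<close> and \<open>t * exp (t / 2) / (exp t - 1) = r / sinh r\<close>.  Since
  \<open>k * coth (k * r)\<close> is the sum of \<open>coth (r + \<i> * \<pi> * j / k)\<close> over \<open>0 \<le> j < k\<close>, pairing \<open>j\<close> with \<open>k - j\<close>
  turns the quotient into
  \<open>cosh r * (\<Sum>j=1..k-1. 1 / (sinh\<^sup>2 r + sin\<^sup>2 (\<pi> * j / k)))\<close>.  Expanding
  \<open>cosh r = sqrt (1 + sinh\<^sup>2 r)\<close> and the fractions in powers of \<open>sinh\<^sup>2 r\<close> gives the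
  right-hand side.
\<close>

section \<open>Finite cosine sums and hyperbolic power series\<close>

definition fps_cosh :: "real fps" where
  "fps_cosh = fps_const (1/2) * (fps_exp 1 + fps_exp (-1))"

text \<open>Real part of the vanishing sum of the powers of a nontrivial \<open>k\<close>-th root of
  unity. Multiplying by \<open>2 * sin x\<close>, with \<open>x\<close> half the angle step, makes
  the sum telescope.\<close>

lemma sum_cos_multiples_eq_0:
  fixes i k :: nat
  assumes "0 < i" "i < k"
  shows "(\<Sum>j<k. cos (real j * (2 * pi * real i / real k))) = 0"
proof -
  define x where "x = pi * real i / real k"
  have telescope: "2 * sin x * (\<Sum>j<n. cos (real j * (2 * x))) = sin ((2 * real n - 1) * x) + sin x" for n
  proof (induction n)
    case (Suc n)
    have "2 * sin x * cos (real n * (2 * x)) = sin ((2 * real n + 1) * x) - sin ((2 * real n - 1) * x)"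
      by (simp add: algebra_simps sin_add sin_diff)
    with Suc show ?case by (simp add: algebra_simps)
  qed simp
  \<comment> \<open>For \<open>n = k\<close> the telescoped endpoint is a whole number of turns
    minus \<open>x\<close>, so the two sines cancel.\<close>
  have "(2 * real k - 1) * x = 2 * pi * real i - x"
    using assms by (simp add: x_def field_simps)
  moreover have "sin (2 * pi * real i - x) = - sin x"
    using sin_2npi[of i] cos_2npi[of i] by (simp add: sin_diff mult_ac)
  ultimately have "sin x * (\<Sum>j<k. cos (real j * (2 * x))) = 0"
    using telescope[of k] by simp
  moreover have "sin x > 0"
    using assms by (intro sin_gt_zero) (auto simp: x_def field_simps)
  ultimately show ?thesis by (simp add: x_def algebra_simps)
qed

text \<open>The quadratic factors as (1 - e^(ip) y)(1 - e^(-ip) y), so this is the real part of a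
  finite geometric series. The three-term recurrence of cos(np) cancels all interior terms.\<close>

lemma fps_cos_geometric_sum:
  fixes y :: "real fps"
  shows "(\<Sum>i<Suc n. fps_const (cos (real i * p)) * y ^ i) * (1 - fps_const (2 * cos p) * y + y\<^sup>2)
    = 1 - fps_const (cos p) * y - fps_const (cos (real (Suc n) * p)) * y ^ Suc n
        + fps_const (cos (real n * p)) * y ^ Suc (Suc n)"
proof (induction n)
  case 0
  have "fps_const (2 * cos p) = 2 * fps_const (cos p)" by (simp add: numeral_fps_const)
  thus ?case by (simp add: algebra_simps power2_eq_square)
next
  case (Suc n)
  have rec: "cos (real (Suc (Suc n)) * p) = 2 * cos p * cos (real (Suc n) * p) - cos (real n * p)"
  proof -
    have "cos (real (Suc n) * p + p) + cos (real (Suc n) * p - p) = 2 * cos p * cos (real (Suc n) * p)"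
      by (simp add: cos_add cos_diff)
    thus ?thesis by (simp add: algebra_simps)
  qed
  show ?case
    unfolding sum.lessThan_Suc[of _ "Suc n"] distrib_right Suc.IH rec
    by (simp add: algebra_simps power2_eq_square flip: fps_const_mult fps_const_sub)
qed

text \<open>Periodicity gives cos((k-1)p) = cos p, and the boundary terms of the finite sum then
  factor.\<close>

lemma fps_cos_geometric_sum_period:
  fixes y :: "real fps"
  assumes "0 < k" "cos (real k * p) = 1"
  shows "(\<Sum>i<k. fps_const (cos (real i * p)) * y ^ i) * (1 - fps_const (2 * cos p) * y + y\<^sup>2)
    = (1 - fps_const (cos p) * y) * (1 - y ^ k)"
proof -
  obtain n where n: "k = Suc n" using assms(1) by (cases k) auto
  have "sin (real k * p) = 0" using assms(2) by (simp add: cos_one_sin_zero)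
  hence "cos (real k * p - p) = cos p" using assms(2) by (simp add: cos_diff)
  hence "cos (real n * p) = cos p" by (simp add: n algebra_simps)
  thus ?thesis using fps_cos_geometric_sum[of p y n] assms(2)
    by (simp add: n algebra_simps)
qed

lemma fps_sinh_nth_0 [simp]: "fps_nth fps_sinh 0 = 0"
  by (simp add: fps_sinh_def)

lemma fps_sinh_nonzero: "fps_sinh \<noteq> 0"
proof
  assume "fps_sinh = 0"
  hence "fps_nth fps_sinh 1 = 0" by simp
  thus False by (simp add: fps_sinh_def)
qed

text \<open>Both sides are 4 e^(2r) sinh(r + it) sinh(r - it). The right-hand side is the quadratic
  of the cosine sums for \<open>y = fps_exp 2\<close> and \<open>p = 2 * t\<close>.\<close>

lemma fps_exp_2_cosh: "4 * fps_exp 2 * (fps_sinh\<^sup>2 + fps_const (sin t ^ 2))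
    = 1 - fps_const (2 * cos (2 * t)) * fps_exp 2 + (fps_exp 2)\<^sup>2"
proof -
  have [simp]: "fps_exp 1 * fps_exp (-1) = (1 :: real fps)" by (simp flip: fps_exp_add_mult)
  have e: "fps_exp 2 = (fps_exp 1 :: real fps)\<^sup>2" by (simp add: fps_exp_power_mult)
  have s: "4 * fps_sinh\<^sup>2 = (fps_exp 1 - fps_exp (-1))\<^sup>2"
  proof -
    have "fps_const 4 * fps_sinh\<^sup>2 = (fps_exp 1 - fps_exp (-1))\<^sup>2"
      unfolding fps_sinh_def power_mult_distrib mult.assoc[symmetric]
      by (simp add: power2_eq_square)
    thus ?thesis by (simp add: numeral_fps_const)
  qed
  have c: "fps_const (2 * cos (2 * t)) = 2 - 4 * fps_const (sin t ^ 2)"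
    by (simp add: cos_double_sin numeral_fps_const)
  have "fps_exp 2 * (fps_exp 1 - fps_exp (-1))\<^sup>2 = ((fps_exp 1)\<^sup>2 - fps_exp 1 * fps_exp (-1) :: real fps)\<^sup>2"
    unfolding e by algebra
  hence "fps_exp 2 * (4 * fps_sinh\<^sup>2) = ((fps_exp 2 - 1) :: real fps)\<^sup>2"
    unfolding s by (simp add: e)
  thus ?thesis unfolding c by algebra
qed

lemma fps_exp_2_sinh_cosh: "4 * fps_exp 2 * fps_sinh * fps_cosh = (fps_exp 2)\<^sup>2 - 1"
proof -
  have [simp]: "fps_exp 1 * fps_exp (-1) = (1 :: real fps)" by (simp flip: fps_exp_add_mult)
  have e: "fps_exp 2 = (fps_exp 1 :: real fps)\<^sup>2" by (simp add: fps_exp_power_mult)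
  have h: "4 * (fps_const (1/2) * fps_const (1/2)) = (1 :: real fps)"
    by (simp add: numeral_fps_const)
  have "4 * fps_exp 2 * fps_sinh * fps_cosh = 4 * (fps_const (1/2) * fps_const (1/2)) *
      (((fps_exp 1)\<^sup>2 - fps_exp 1 * fps_exp (-1)) * ((fps_exp 1)\<^sup>2 + fps_exp 1 * fps_exp (-1)))"
    unfolding e fps_sinh_def fps_cosh_def by algebra
  also have "\<dots> = (fps_exp 2)\<^sup>2 - 1" unfolding h
    by (simp add: e algebra_simps power2_eq_square)
  finally show ?thesis .
qed

lemma fps_cosh_squared: "fps_cosh\<^sup>2 = 1 + fps_sinh\<^sup>2"
proof -
  have [simp]: "fps_exp 1 * fps_exp (-1) = (1 :: real fps)" by (simp flip: fps_exp_add_mult)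
  have h: "4 * (fps_const (1/2) * fps_const (1/2)) = (1 :: real fps)"
    by (simp add: numeral_fps_const)
  have "fps_cosh\<^sup>2 - fps_sinh\<^sup>2 = 4 * (fps_const (1/2) * fps_const (1/2)) * (fps_exp 1 * fps_exp (-1))"
    unfolding fps_sinh_def fps_cosh_def by algebra
  thus ?thesis unfolding h by (simp add: algebra_simps)
qed

text \<open>Both series square to \<open>1 + fps_sinh\<^sup>2\<close>; as both have constant term 1,
  they cannot be negatives of each other.\<close>

lemma fps_cosh_binomial: "fps_cosh = fps_binomial (1/2) oo fps_sinh\<^sup>2"
proof -
  define P where "P = fps_binomial (1/2 :: real) oo fps_sinh\<^sup>2"
  have "P\<^sup>2 = (fps_binomial (1/2))\<^sup>2 oo fps_sinh\<^sup>2"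
    unfolding P_def by (rule fps_compose_power) simp
  also have "\<dots> = 1 + fps_sinh\<^sup>2"
    by (simp add: fps_binomial_power fps_binomial_1 fps_compose_add_distrib)
  finally have "(fps_cosh - P) * (fps_cosh + P) = 0"
    using fps_cosh_squared by (simp add: algebra_simps power2_eq_square)
  moreover have "fps_nth (fps_cosh + P) 0 \<noteq> 0" by (simp add: P_def fps_cosh_def)
  hence "fps_cosh + P \<noteq> 0" by force
  ultimately show ?thesis by (simp add: P_def)
qed

section \<open>Cosecant sums and partial fractions\<close>

definition cosec_series :: "nat \<Rightarrow> nat \<Rightarrow> real fps" where
  "cosec_series k j = Abs_fps (\<lambda>m. (-1) ^ m / sin (real j * (pi / real k)) ^ (2 * m + 2))"

text \<open>The signed cosecant powers are the coefficients in the geometric expansion of 1/(X + s),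
  where s is the squared sine.\<close>

lemma cosec_series_inverse:
  assumes "sin (real j * (pi / real k)) \<noteq> 0"
  shows "cosec_series k j * (fps_X + fps_const (sin (real j * (pi / real k)) ^ 2)) = 1"
proof (rule fps_ext)
  fix n
  show "fps_nth (cosec_series k j * (fps_X + fps_const (sin (real j * (pi / real k)) ^ 2))) n = fps_nth 1 n"
    using assms by (cases n) (simp_all add: cosec_series_def distrib_left power2_eq_square field_simps)
qed

lemma cosec_coeff_eq_nth:
  "cosec_coeff l k = fps_nth (fps_binomial (1/2) * (\<Sum>j=1..k-1. cosec_series k j)) l"
  by (simp add: cosec_coeff_def fps_mult_nth fps_sum_nth cosec_series_def sum_distrib_left
      mult.assoc) (rule sum.swap)

lemma sum_cosec_coeff_eq_nth:
  "(\<Sum>l=0..\<eta>. cosec_coeff l k * sinh_coeff (2*l) (2*\<eta>))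
    = fps_nth (fps_cosh * ((\<Sum>j=1..k-1. cosec_series k j) oo fps_sinh\<^sup>2)) (2*\<eta>)"
proof -
  have "fps_nth (fps_cosh * ((\<Sum>j=1..k-1. cosec_series k j) oo fps_sinh\<^sup>2)) (2*\<eta>)
    = (\<Sum>l=0..2*\<eta>. cosec_coeff l k * fps_nth (fps_sinh ^ (2*l)) (2*\<eta>))"
    unfolding fps_cosh_binomial cosec_coeff_eq_nth
    by (subst fps_compose_mult_distrib[symmetric]) (simp_all add: fps_compose_nth power_mult)
  \<comment> \<open>\<open>fps_sinh ^ (2*l)\<close> has no terms below degree \<open>2*l\<close>, so
    every \<open>l > \<eta>\<close> contributes 0.\<close>
  also have "\<dots> = (\<Sum>l=0..\<eta>. cosec_coeff l k * fps_nth (fps_sinh ^ (2*l)) (2*\<eta>))"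
    by (intro sum.mono_neutral_right) (auto simp: startsby_zero_power_prefix)
  finally show ?thesis by (simp add: sinh_coeff_def)
qed

text \<open>
  With \<open>y = exp (2 * r)\<close>, this is the partial fraction expansion
  \<open>k * coth (k * r) - coth r = (\<Sum>j=1..k-1. sinh r * cosh r / (sinh\<^sup>2 r + sin\<^sup>2 (j * \<pi> / k)))\<close>
  cleared of denominators.
\<close>

lemma coth_partial_fractions:
  fixes k :: nat
  assumes "k \<ge> 2"
  defines "y \<equiv> fps_exp (2::real)"
  shows "fps_sinh * (fps_cosh * ((\<Sum>j=1..k-1. cosec_series k j) oo fps_sinh\<^sup>2)) * ((y ^ k - 1) * (y - 1))
    = of_nat k * (y ^ k + 1) * (y - 1) - (y + 1) * (y ^ k - 1)"
proof -
  define V where "V j = cosec_series k j oo fps_sinh\<^sup>2" for j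
  define c where "c i j = cos (real i * (2 * (real j * (pi / real k))))" for i j :: nat
  \<comment> \<open>Here \<open>V j\<close> is 1/D with D = sinh^2 + sin^2 t. Thus 1 - sinh cosh / D
    equals 2(1 - cos(2t) y)/(4yD), which the periodic cosine sum evaluates once multiplied by
    \<open>1 - y ^ k\<close>.\<close>
  have single: "(1 - y ^ k) * (1 - fps_sinh * fps_cosh * V j) = 2 * (\<Sum>i<k. fps_const (c i j) * y ^ i)"
    if j: "j \<in> {1..k-1}" for j
  proof -
    define t where "t = real j * (pi / real k)"
    define A where "A = (\<Sum>i<k. fps_const (c i j) * y ^ i)"
    define D where "D = fps_sinh\<^sup>2 + fps_const (sin t ^ 2)"
    have "sin t > 0"
      using j assms(1) by (intro sin_gt_zero) (auto simp: t_def field_simps)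
    hence "cosec_series k j * (fps_X + fps_const (sin t ^ 2)) = 1"
      using cosec_series_inverse[of j k] by (simp add: t_def)
    hence "(cosec_series k j * (fps_X + fps_const (sin t ^ 2))) oo fps_sinh\<^sup>2 = 1" by simp
    hence VD: "V j * D = 1"
      by (simp add: fps_compose_mult_distrib fps_compose_add_distrib V_def D_def)
    have "real k * (2 * t) = 2 * pi * real j" using assms(1) by (simp add: t_def)
    hence "cos (real k * (2 * t)) = 1" using cos_2npi[of j] by (simp only: mult_ac)
    from fps_cos_geometric_sum_period[OF _ this, of y] assms(1)
    have A: "A * (4 * y * D) = (1 - fps_const (cos (2 * t)) * y) * (1 - y ^ k)"
      unfolding A_def D_def y_def fps_exp_2_cosh c_def t_def by simp
    have "2 * (1 - fps_const (cos (2 * t)) * y)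
        = (1 - fps_const (2 * cos (2 * t)) * y + y\<^sup>2) - (y\<^sup>2 - 1)"
      by (simp add: algebra_simps numeral_fps_const)
    also have "\<dots> = 4 * y * D - 4 * y * fps_sinh * fps_cosh"
      unfolding y_def D_def fps_exp_2_cosh fps_exp_2_sinh_cosh ..
    finally have B: "2 * (1 - fps_const (cos (2 * t)) * y) = 4 * y * D - 4 * y * fps_sinh * fps_cosh" .
    have "4 * y * (2 * A) = 2 * A * (4 * y) * (V j * D)"
      unfolding VD by simp
    also have "\<dots> = 2 * V j * (A * (4 * y * D))" by (simp add: mult_ac)
    also have "\<dots> = V j * (1 - y ^ k) * (2 * (1 - fps_const (cos (2 * t)) * y))"
      unfolding A by (simp add: mult_ac)
    also have "\<dots> = 4 * y * (1 - y ^ k) * (V j * D - fps_sinh * fps_cosh * V j)"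
      unfolding B by (simp add: algebra_simps)
    also have "\<dots> = 4 * y * ((1 - y ^ k) * (1 - fps_sinh * fps_cosh * V j))"
      unfolding VD by (simp add: algebra_simps)
    finally have "4 * y * ((1 - y ^ k) * (1 - fps_sinh * fps_cosh * V j)) = 4 * y * (2 * A)" ..
    moreover have "4 * y \<noteq> 0" by (simp add: y_def)
    ultimately show ?thesis unfolding A_def by (rule mult_left_cancel[THEN iffD1, rotated])
  qed
  \<comment> \<open>Over all \<open>j < k\<close> the sum is \<open>k\<close> for
    \<open>i = 0\<close> and 0 otherwise; the \<open>-1\<close> removes the term
    \<open>j = 0\<close>, where the cosine is 1.\<close>
  have csum: "(\<Sum>j=1..k-1. c i j) = (if i = 0 then real k else 0) - 1" if "i < k" for i
  proof -
    have "(\<Sum>j<k. c i j) = (if i = 0 then real k else 0)"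
      using sum_cos_multiples_eq_0[of i k] that by (simp add: c_def field_simps)
    moreover have "{..<k} = insert 0 {1..k-1}" using assms(1) by auto
    ultimately show ?thesis by (simp add: c_def)
  qed
  define T where "T = (\<Sum>j=1..k-1. V j)"
  have T: "T = (\<Sum>j=1..k-1. cosec_series k j) oo fps_sinh\<^sup>2"
    by (simp add: T_def V_def fps_compose_sum_distrib)
  have k1: "of_nat (k - 1) = (of_nat k - 1 :: real fps)" using assms(1) by (simp add: of_nat_diff)
  have "(1 - y ^ k) * (of_nat k - 1 - fps_sinh * fps_cosh * T)
      = (\<Sum>j=1..k-1. (1 - y ^ k) * (1 - fps_sinh * fps_cosh * V j))"
    unfolding T_def sum_distrib_left[symmetric] sum_subtractf
    by (simp add: k1[symmetric])
  also have "\<dots> = (\<Sum>j=1..k-1. 2 * (\<Sum>i<k. fps_const (c i j) * y ^ i))"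
    by (intro sum.cong refl single)
  also have "\<dots> = 2 * (\<Sum>i<k. \<Sum>j=1..k-1. fps_const (c i j) * y ^ i)"
    unfolding sum_distrib_left[symmetric] by (subst sum.swap) (rule refl)
  also have "(\<Sum>i<k. \<Sum>j=1..k-1. fps_const (c i j) * y ^ i)
      = (\<Sum>i<k. fps_const (\<Sum>j=1..k-1. c i j) * y ^ i)"
    by (intro sum.cong refl fps_ext) (simp add: fps_sum_nth sum_distrib_right)
  also have "\<dots> = (\<Sum>i<k. (if i = 0 then of_nat k else 0) - y ^ i)"
    by (intro sum.cong refl, subst csum) (auto simp: fps_of_nat simp flip: fps_const_sub fps_const_neg)
  also have "\<dots> = of_nat k - (\<Sum>i<k. y ^ i)"
    using assms(1) by (simp add: sum_subtractf)
  finally have main: "(1 - y ^ k) * (of_nat k - 1 - fps_sinh * fps_cosh * T)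
      = 2 * (of_nat k - (\<Sum>i<k. y ^ i))" .
  \<comment> \<open>A further factor \<open>1 - y\<close> collapses the remaining geometric sum,
    leaving only \<open>y\<close> and \<open>y ^ k\<close> on the right.\<close>
  have geo: "(1 - y) * (\<Sum>i<k. y ^ i) = 1 - y ^ k" by (rule one_diff_power_eq[symmetric])
  have "(1 - y) * ((1 - y ^ k) * (of_nat k - 1 - fps_sinh * fps_cosh * T))
      = 2 * (of_nat k * (1 - y) - (1 - y) * (\<Sum>i<k. y ^ i))"
    unfolding main by (simp add: algebra_simps)
  thus ?thesis unfolding geo T[symmetric] by (simp add: algebra_simps)
qed

section \<open>Bernoulli generating functions\<close>

definition bernpoly_fps :: "real \<Rightarrow> real fps" where
  "bernpoly_fps x = fps_X * fps_exp x / (fps_exp 1 - 1)"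

lemma fps_exp_minus_one_nonzero:
  assumes "c \<noteq> 0"
  shows "fps_exp c - 1 \<noteq> (0 :: real fps)"
proof
  assume "fps_exp c - 1 = 0"
  hence "fps_nth (fps_exp c - 1) 1 = 0" by simp
  thus False using assms by simp
qed

text \<open>Numerator and denominator both have order 1, so the division is exact.\<close>

lemma bernpoly_fps_mult: "bernpoly_fps x * (fps_exp 1 - 1) = fps_X * fps_exp x"
proof -
  have "subdegree (fps_exp (1::real) - 1) = 1" "subdegree (fps_X * fps_exp x) = 1"
    by (intro subdegreeI; auto)+
  moreover have "fps_X * fps_exp x \<noteq> 0" by simp
  ultimately have "fps_exp 1 - 1 dvd fps_X * fps_exp x"
    using fps_exp_minus_one_nonzero[of 1] by (subst fps_dvd_iff) auto
  thus ?thesis by (simp add: bernpoly_fps_def)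
qed

lemma bernpoly_fps_compose_linear:
  "(bernpoly_fps x oo (fps_const c * fps_X)) * (fps_exp c - 1) = fps_const c * fps_X * fps_exp (x * c)"
proof -
  have "(bernpoly_fps x * (fps_exp 1 - 1)) oo (fps_const c * fps_X)
      = (fps_X * fps_exp x) oo (fps_const c * fps_X)"
    by (simp add: bernpoly_fps_mult)
  thus ?thesis by (simp add: fps_compose_mult_distrib fps_compose_sub_distrib)
qed

text \<open>Adding \<open>X/2\<close> removes the only nonzero odd Bernoulli number.\<close>

definition bernoulli_even_fps :: "real fps" where
  "bernoulli_even_fps = bernpoly_fps 0 + fps_const (1/2) * fps_X"

text \<open>Denominator-free form of (cX/2) coth(cX/2): X/(e^X - 1) + X/2 equals X(e^X + 1)/(2(e^X -
  1)), with X then replaced by cX.\<close>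

lemma bernoulli_even_fps_compose_linear:
  "(bernoulli_even_fps oo (fps_const c * fps_X)) * (fps_exp c - 1) * 2
    = fps_const c * fps_X * (fps_exp c + 1)"
proof -
  have h: "2 * fps_const (1/2) = (1 :: real fps)" by (simp add: numeral_fps_const)
  have B: "(bernpoly_fps 0 oo (fps_const c * fps_X)) * (fps_exp c - 1) = fps_const c * fps_X"
    using bernpoly_fps_compose_linear[of 0 c] by simp
  have "bernoulli_even_fps oo (fps_const c * fps_X)
      = (bernpoly_fps 0 oo (fps_const c * fps_X)) + fps_const (1/2) * (fps_const c * fps_X)"
    by (simp add: bernoulli_even_fps_def fps_compose_add_distrib fps_compose_mult_distrib
        del: fps_const_mult)
  with B h show ?thesis by algebra
qed

text \<open>Multiplied by e^X, the rescaled equation for c = -1 becomes, up to sign, the one for c =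
  1. Cancellation shows that the series is invariant under X -> -X.\<close>

lemma bernoulli_even_fps_odd_nth:
  assumes "odd n"
  shows "fps_nth bernoulli_even_fps n = 0"
proof -
  let ?G = "bernoulli_even_fps"
  let ?H = "?G oo (fps_const (-1) * fps_X)"
  have [simp]: "fps_exp 1 * fps_exp (-1) = (1 :: real fps)" by (simp flip: fps_exp_add_mult)
  have "?H * (fps_exp (-1) - 1) * 2 = - fps_X * (fps_exp (-1) + 1)"
    by (subst bernoulli_even_fps_compose_linear) (simp flip: fps_const_neg)
  hence "?H * (fps_exp 1 * fps_exp (-1) - fps_exp 1) * 2 = - fps_X * (fps_exp 1 * fps_exp (-1) + fps_exp 1)"
    by algebra
  hence "?H * (fps_exp 1 - 1) * 2 = fps_X * (fps_exp 1 + 1)" by (simp add: algebra_simps)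
  moreover have "?G * (fps_exp 1 - 1) * 2 = fps_X * (fps_exp 1 + 1)"
    using bernoulli_even_fps_compose_linear[of 1] by simp
  ultimately have "?H * ((fps_exp 1 - 1) * 2) = ?G * ((fps_exp 1 - 1) * 2)" by (simp add: mult.assoc)
  hence "?H = ?G" using fps_exp_minus_one_nonzero[of 1] by simp
  hence "fps_nth ?H n = fps_nth ?G n" by simp
  thus ?thesis using assms unfolding fps_compose_linear by simp
qed

lemma bernpoly_eq_nth: "bernpoly m x = fact m * fps_nth (bernpoly_fps x) m"
  by (simp add: bernpoly_def bernpoly_fps_def)

text \<open>The summand X/2 changes only the coefficient of degree 1.\<close>

lemma bernoulli_even_eq_nth: "bernoulli (2*l) = fact (2*l) * fps_nth bernoulli_even_fps (2*l)"
  by (simp add: bernoulli_def bernpoly_eq_nth bernoulli_even_fps_def fps_X_nth)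

text \<open>The difference of the rescalings by \<open>2 * real k\<close> and by \<open>2\<close>
  supplies the factor \<open>real k ^ (2*l) - 1\<close>. The common scaling by 2 contributes
  \<open>2 ^ (2*\<eta>+2)\<close>, which \<open>4 ^ (\<eta>+1)\<close> cancels.\<close>

lemma bernoulli_sum_eq_nth:
  fixes k \<eta> :: nat
  shows "(\<Sum>l=1..\<eta>+1. real ((2*\<eta>+2) choose (2*l)) * bernpoly (2*\<eta>+2 - 2*l) (1/2)
            * bernoulli (2*l) * (real k ^ (2*l) - 1))
    = fact (2*\<eta>+2) / 4 ^ (\<eta>+1) * fps_nth ((bernpoly_fps (1/2) oo (fps_const 2 * fps_X)) *
        ((bernoulli_even_fps oo (fps_const (2 * real k) * fps_X))
          - (bernoulli_even_fps oo (fps_const 2 * fps_X)))) (2*\<eta>+2)"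
proof -
  define M where "M = 2 * \<eta> + 2"
  define b where "b = fps_nth (bernpoly_fps (1/2))"
  define g where "g = fps_nth bernoulli_even_fps"
  define f where "f n = g n * (real k ^ n - 1) * b (M - n)" for n
  have "fps_nth ((bernpoly_fps (1/2) oo (fps_const 2 * fps_X)) *
        ((bernoulli_even_fps oo (fps_const (2 * real k) * fps_X))
          - (bernoulli_even_fps oo (fps_const 2 * fps_X)))) M
      = (\<Sum>n=0..M. ((2 * real k) ^ n * g n - 2 ^ n * g n) * (2 ^ (M - n) * b (M - n)))"
    unfolding fps_compose_linear b_def g_def mult.commute[of "Abs_fps (\<lambda>n. 2 ^ n * fps_nth (bernpoly_fps (1/2)) n)"]
    by (simp add: fps_mult_nth)
  also have "\<dots> = (\<Sum>n=0..M. 2 ^ M * f n)"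
  proof (intro sum.cong refl)
    fix n assume "n \<in> {0..M}"
    hence "(2::real) ^ M = 2 ^ n * 2 ^ (M - n)" by (simp flip: power_add)
    thus "((2 * real k) ^ n * g n - 2 ^ n * g n) * (2 ^ (M - n) * b (M - n)) = 2 ^ M * f n"
      by (simp add: f_def power_mult_distrib algebra_simps)
  qed
  \<comment> \<open>Only positive even \<open>n\<close> survive: \<open>n = 0\<close> is killed by
    \<open>real k ^ 0 - 1\<close>, odd \<open>n\<close> by the evenness of
    \<open>bernoulli_even_fps\<close>.\<close>
  also have "\<dots> = 2 ^ M * (\<Sum>n\<in>(\<lambda>l. 2 * l) ` {1..\<eta>+1}. f n)"
    unfolding sum_distrib_left[symmetric]
  proof (intro arg_cong2[of _ _ _ _ "(*)"] refl sum.mono_neutral_right ballI)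
    fix n assume n: "n \<in> {0..M} - (\<lambda>l. 2 * l) ` {1..\<eta>+1}"
    have "n = 0 \<or> odd n"
    proof (rule ccontr)
      assume "\<not> (n = 0 \<or> odd n)"
      then obtain l where "n = 2 * l" "l \<noteq> 0" by (auto elim: evenE)
      with n show False by (auto simp: M_def)
    qed
    thus "f n = 0" using bernoulli_even_fps_odd_nth[of n] by (auto simp: f_def g_def)
  qed (auto simp: M_def)
  also have "\<dots> = 2 ^ M * (\<Sum>l=1..\<eta>+1. f (2 * l))"
    by (subst sum.reindex) (auto simp: inj_on_def)
  finally have nth: "fps_nth ((bernpoly_fps (1/2) oo (fps_const 2 * fps_X)) *
        ((bernoulli_even_fps oo (fps_const (2 * real k) * fps_X))
          - (bernoulli_even_fps oo (fps_const 2 * fps_X)))) M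
      = 2 ^ M * (\<Sum>l=1..\<eta>+1. f (2 * l))" .
  have "(\<Sum>l=1..\<eta>+1. real (M choose (2*l)) * bernpoly (M - 2*l) (1/2)
            * bernoulli (2*l) * (real k ^ (2*l) - 1)) = (\<Sum>l=1..\<eta>+1. fact M * f (2 * l))"
  proof (intro sum.cong refl)
    fix l assume "l \<in> {1..\<eta>+1}"
    hence "real (M choose (2*l)) = fact M / (fact (2*l) * fact (M - 2*l))"
      by (intro binomial_fact) (auto simp: M_def)
    thus "real (M choose (2*l)) * bernpoly (M - 2*l) (1/2)
            * bernoulli (2*l) * (real k ^ (2*l) - 1) = fact M * f (2 * l)"
      by (simp add: bernpoly_eq_nth bernoulli_even_eq_nth f_def b_def g_def)
  qed
  moreover have "(4::real) ^ (\<eta>+1) = 2 ^ M"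
    by (simp add: M_def power_mult power_add)
  ultimately show ?thesis
    unfolding M_def[symmetric] nth by (simp add: sum_distrib_left[symmetric])
qed

section \<open>Comparison of coefficients\<close>

theorem theorem3p54:
  fixes k \<eta> :: nat
  assumes "k \<ge> 2"
  shows "(\<Sum>l=1..\<eta>+1. real ((2*\<eta>+2) choose (2*l)) * bernpoly (2*\<eta>+2 - 2*l) (1/2)
            * bernoulli (2*l) * (real k ^ (2*l) - 1))
       = fact (2*\<eta>+2) / 4 ^ (\<eta>+1) * (\<Sum>l=0..\<eta>. cosec_coeff l k * sinh_coeff (2*l) (2*\<eta>))"
proof -
  define y where "y = fps_exp (2::real)"
  define W where "W = fps_cosh * ((\<Sum>j=1..k-1. cosec_series k j) oo fps_sinh\<^sup>2)"
  define F where "F = bernpoly_fps (1/2) oo (fps_const 2 * fps_X)"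
  define G where "G c = bernoulli_even_fps oo (fps_const c * fps_X)" for c
  have yk: "y ^ k = fps_exp (2 * real k)" by (simp add: y_def fps_exp_power_mult mult.commute)
  have y_sinh: "y - 1 = 2 * fps_exp 1 * fps_sinh"
  proof -
    have h: "2 * fps_const (1/2) = (1 :: real fps)" by (simp add: numeral_fps_const)
    have "2 * fps_exp 1 * fps_sinh = (2 * fps_const (1/2)) * (fps_exp 1 * (fps_exp 1 - fps_exp (-1)))"
      unfolding fps_sinh_def by algebra
    thus ?thesis unfolding h by (simp add: right_diff_distrib y_def flip: fps_exp_add_mult)
  qed
  \<comment> \<open>Since y - 1 = 2 e^X sinh X, this says that \<open>F\<close> is X / sinh
    X.\<close>
  have "F * (y - 1) = 2 * fps_X * fps_exp 1"
    unfolding F_def y_def bernpoly_fps_compose_linear by (simp add: numeral_fps_const)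
  hence "(2 * fps_exp 1) * (F * fps_sinh) = (2 * fps_exp 1) * fps_X"
    unfolding y_sinh by (simp add: mult_ac)
  hence F: "F * fps_sinh = fps_X" by simp
  \<comment> \<open>In quotient form, \<open>G 2\<close> is X coth X and
    \<open>G (2 * real k)\<close> is kX coth(kX).\<close>
  have G1: "G 2 * (y - 1) = fps_X * (y + 1)"
  proof -
    have "2 * (G 2 * (y - 1)) = 2 * (fps_X * (y + 1))"
      using bernoulli_even_fps_compose_linear[of 2]
      by (simp add: G_def y_def numeral_fps_const mult_ac)
    thus ?thesis by simp
  qed
  have Gk: "G (2 * real k) * (y ^ k - 1) = of_nat k * fps_X * (y ^ k + 1)"
  proof -
    have "fps_const (2 * real k) = 2 * of_nat k"
      by (simp add: numeral_fps_const fps_of_nat flip: fps_const_mult)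
    hence "2 * (G (2 * real k) * (y ^ k - 1)) = 2 * (of_nat k * fps_X * (y ^ k + 1))"
      using bernoulli_even_fps_compose_linear[of "2 * real k"]
      by (simp add: G_def yk mult_ac)
    thus ?thesis by simp
  qed
  \<comment> \<open>\<open>Q\<close> is a common denominator for both sides; being nonzero in an
    integral domain, it can be cancelled at the end.\<close>
  define Q where "Q = fps_sinh * ((y ^ k - 1) * (y - 1))"
  have Q: "Q \<noteq> 0"
    using fps_sinh_nonzero fps_exp_minus_one_nonzero[of 2] fps_exp_minus_one_nonzero[of "2 * real k"] assms
    unfolding Q_def yk by (simp add: y_def)
  have "fps_sinh * W * ((y ^ k - 1) * (y - 1))
      = of_nat k * (y ^ k + 1) * (y - 1) - (y + 1) * (y ^ k - 1)"
    using coth_partial_fractions[OF assms] unfolding W_def y_def .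
  hence W: "W * Q = of_nat k * (y ^ k + 1) * (y - 1) - (y + 1) * (y ^ k - 1)"
    unfolding Q_def by (simp add: mult_ac)
  have "(F * (G (2 * real k) - G 2)) * Q
      = (F * fps_sinh) * ((G (2 * real k) * (y ^ k - 1)) * (y - 1) - (G 2 * (y - 1)) * (y ^ k - 1))"
    unfolding Q_def by (simp add: algebra_simps)
  also have "\<dots> = fps_X\<^sup>2 * (W * Q)"
    unfolding F G1 Gk W by (simp add: algebra_simps power2_eq_square)
  finally have "(F * (G (2 * real k) - G 2)) * Q = (fps_X\<^sup>2 * W) * Q"
    by (simp add: mult.assoc)
  with Q have "F * (G (2 * real k) - G 2) = fps_X\<^sup>2 * W" by simp
  \<comment> \<open>The factor X^2 accounts for the shift from index \<open>2 * \<eta> + 2\<close>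
    to \<open>2 * \<eta>\<close>.\<close>
  hence "fps_nth (F * (G (2 * real k) - G 2)) (2 * \<eta> + 2) = fps_nth W (2 * \<eta>)"
    by (simp add: fps_X_power_mult_nth)
  thus ?thesis
    unfolding bernoulli_sum_eq_nth sum_cosec_coeff_eq_nth F_def G_def W_def by simp
qed

end
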